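(* $r_5(6,6) \ge 72$.
   Context: For integers $k,p,q$, the Ramsey number $r_k(p,q)$ is the smallest integer $N$ such that for every coloring of all $k$-element subsets of $\{1,\dots,N\}$ with the colors red and blue, there exist either $p$ elements of $\{1,\dots,N\}$ all of whose $k$-element subsets are red, or $q$ elements of $\{1,\dots,N\}$ all of whose $k$-element subsets are blue. *)

theory Defs
  imports "HOL-Library.Ramsey"
begin

text \<open>A colouring maps the k-element subsets of {1..N} to {0, 1}; colour 0 is red (clique size p)
  and colour 1 is blue (clique size q).\<close>

definition ramsey_number :: "nat \<Rightarrow> nat \<Rightarrow> nat \<Rightarrow> nat" where
  "ramsey_number k p q = (LEAST N. partn_lst {1..N} [p, q] k)"

text \<open>The minimum is taken over a nonempty set, so LEAST is meaningful.\<close>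

lemma ramsey_number_exists: "\<exists>N::nat. partn_lst {1..N} [p, q] k"
proof -
  obtain N :: nat where N: "partn_lst {..<N} [p, q] k"
    using ramsey_full by blast
  have "partn_lst {1..N} [p, q] k"
    unfolding partn_lst_def
  proof
    fix f assume f: "f \<in> nsets {1..N} k \<rightarrow> {..<length [p, q]}"
    have im: "Suc ` X \<in> nsets {1..N} m" if "X \<in> nsets {..<N} m" for X m
      using that by (auto simp: nsets_def card_image)
    have "(\<lambda>X. f (Suc ` X)) \<in> nsets {..<N} k \<rightarrow> {..<length [p, q]}"
      using f im by blast
    then obtain i H where i: "i < length [p, q]" and H: "H \<in> nsets {..<N} ([p, q] ! i)"
      and mono: "(\<lambda>X. f (Suc ` X)) ` nsets H k \<subseteq> {i}"
      using N unfolding partn_lst_def monochromatic_def by blast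
    have "f ` nsets (Suc ` H) k \<subseteq> {i}"
    proof clarify
      fix Y assume Y: "Y \<in> nsets (Suc ` H) k"
      then obtain X where X: "X \<subseteq> H" "Y = Suc ` X"
        by (auto simp: nsets_def subset_image_iff)
      with Y have "X \<in> nsets H k"
        by (auto simp: nsets_def card_image finite_image_iff)
      with mono X(2) show "f Y = i" by blast
    qed
    with i im[OF H] show "\<exists>i<length [p, q]. monochromatic {1..N} ([p, q] ! i) k f i"
      unfolding monochromatic_def by blast
  qed
  then show ?thesis ..
qed

end

theory Submission
  imports Defs "HOL-Number_Theory.Cong"
begin

text \<open>
  The theorem asks for a colouring of the 5-element subsets of a 71-element set without a
  monochromatic 6-element subset. The point set is the field \<open>\<int>/71\<close>, represented
  by the integers 0 to 70, and the colouring is invariant under all maps \<open>x \<mapsto> u x +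
  v\<close> with \<open>u \<noteq> 0\<close>. Their number, 71 \<open>\<cdot>\<close> 70, is not
  divisible by 3, so no group of such maps acts transitively on the points of a 6-set, which would
  make the 6-set monochromatic.

  To make invariance automatic, the colour of a 5-set \<open>S\<close> is read off from an
  invariant \<open>hash S\<close>. An ordered triple \<open>x, y, z\<close> has the affine
  invariant \<open>ratio x y z = (z - x) / (y - x)\<close>, and permuting the triple acts on it by
  \<open>r \<mapsto> 1 / r\<close> and \<open>r \<mapsto> 1 - r\<close>. A function
  \<open>weight\<close> that is constant on the twelve classes of ratios under these two maps
  gives a symmetric affine invariant \<open>wt x y z\<close> of triples, and \<open>hash S\<close>
  is twice the sum of \<open>wt\<close> over the ten triples in \<open>S\<close>. Two lists say
  which hash values are red and which are blue (\<open>hue\<close>). The weights and the lists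
  were found by a computer search: each 6-set imposes the condition that not all of its 5-subsets
  have the same colour, and the resulting satisfiability problem has a solution. There is one
  exception: up to affine maps there is a single 6-set, \<open>{0, 1, 6, 7, 12, 13}\<close>, all
  of whose 5-subsets have the same hash, namely 15276. For this hash value a second affine
  invariant, the additive energy, decides the colour.

  That no 6-set \<open>T\<close> is monochromatic (lemma \<open>two_colours\<close>) is verified
  as follows. Choose a triple of minimal weight in \<open>T\<close>, ordered so that its ratio
  \<open>t\<close> is one of twelve representatives, and map it to \<open>0, 1, t\<close>. Then
  \<open>T\<close> becomes \<open>{0, 1, t, b, c, d}\<close> with \<open>b < c < d\<close>, and
  every triple has weight at least \<open>wt 0 1 t\<close>. For given \<open>t\<close>, the hues
  of the sets \<open>{0, 1, t, b, c}\<close> colour the edges of a graph with vertices in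
  \<open>{2..70}\<close>; only its triangles without both a red and a blue edge need the three
  remaining 5-subsets of \<open>T\<close>. The minimality condition removes nothing for \<open>t =
  3\<close>, where the weight is 0 and there are 50116 triples \<open>(b, c, d)\<close>, but
  leaves only about 10600 triples for the other eleven \<open>t\<close> together. The function
  \<open>check\<close> goes through them; lemma \<open>check_sound\<close> states what its success
  means, and the lemmas \<open>check_3\<close>, \<open>check_4\<close>, \<open>check_6\<close> and
  \<open>check_rest\<close> run it by rewriting.
\<close>

section \<open>Affine invariants modulo 71\<close>

text \<open>
  The inverses of 0, ..., 70 modulo 71, where 0 is its own inverse by convention.
\<close>

definition inverses :: "int list" where
  "inverses = [
    0, 1, 36, 24, 18, 57, 12, 61, 9, 8, 64, 13, 6, 11, 66, 19, 40, 46, 4, 15, 32, 44, 42, 34,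
    3, 54, 41, 50, 33, 49, 45, 55, 20, 28, 23, 69, 2, 48, 43, 51, 16, 26, 22, 38, 21, 30, 17,
    68, 37, 29, 27, 39, 56, 67, 25, 31, 52, 5, 60, 65, 58, 7, 63, 62, 10, 59, 14, 53, 47, 35, 70]"

text \<open>
  Inversion modulo 71, depending only on the residue of \<open>d\<close> and 0 on multiples of 71.
\<close>

definition inv71 :: "int \<Rightarrow> int" where
  "inv71 d = inverses ! nat (d mod 71)"

text \<open>
  The weights of the ratios 0, ..., 70. The entries at 0 and 1 belong to degenerate triples and
  are 0; the others are constant on the twelve classes of ratios. The weights are spread out so
  that their sums over the triples of a 5-set separate most of the orbits of 5-sets.
\<close>

definition weights :: "int list" where
  "weights = [
    0, 0, 371, 0, 1, 297, 306, 984, 1397, 1397, 1397, 984, 306, 984, 306, 297, 2253, 1265, 1,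
    297, 2253, 914, 2107, 1746, 0, 1, 1265, 2107, 914, 1746, 2107, 1265, 2253, 914, 1746, 0,
    371, 0, 1746, 914, 2253, 1265, 2107, 1746, 914, 2107, 1265, 1, 0, 1746, 2107, 914, 2253,
    297, 1, 1265, 2253, 297, 306, 984, 306, 984, 1397, 1397, 1397, 984, 306, 297, 1, 0, 371]"

definition weight :: "int \<Rightarrow> int" where
  "weight r = weights ! nat r"

text \<open>
  The affine invariant of an ordered triple: the image of \<open>z\<close> under the affine map
  that takes \<open>x\<close> to 0 and \<open>y\<close> to 1. If \<open>x\<close> and
  \<open>y\<close> agree modulo 71 it is 0.
\<close>

definition ratio :: "int \<Rightarrow> int \<Rightarrow> int \<Rightarrow> int" where
  "ratio x y z = (z - x) * inv71 (y - x) mod 71"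

definition wt :: "int \<Rightarrow> int \<Rightarrow> int \<Rightarrow> int" where
  "wt x y z = weight (ratio x y z)"

lemma upto70: "[1..70::int] = [1, 2, 3, 4, 5, 6, 7, 8, 9, 10, 11, 12, 13, 14, 15, 16, 17, 18, 19, 20, 21, 22, 23, 24, 25,
    26, 27, 28, 29, 30, 31, 32, 33, 34, 35, 36, 37, 38, 39, 40, 41, 42, 43, 44, 45, 46, 47, 48,
    49, 50, 51, 52, 53, 54, 55, 56, 57, 58, 59, 60, 61, 62, 63, 64, 65, 66, 67, 68, 69, 70]"
  by code_simp

lemma residues_eq: "{0..70::int} = set (0 # [1..70])"
proof -
  have "{0..70::int} = insert 0 {1..70}" by auto
  then show ?thesis by (simp only: list.set set_upto)
qed

lemma inv71_list: "map inv71 (0 # [1..70]) = inverses"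
  unfolding upto70 by (simp add: inv71_def inverses_def)

lemmas inv71_rules = inv71_list[unfolded upto70 inverses_def list.map list.inject simp_thms]

lemma weight_list: "map weight (0 # [1..70]) = weights"
  unfolding upto70 by (simp add: weight_def weights_def)

lemmas weight_rules = weight_list[unfolded upto70 weights_def list.map list.inject simp_thms]

lemma inv71_table: "\<forall>d\<in>{0..70}.
    0 \<le> inv71 d \<and> inv71 d \<le> 70 \<and> d * inv71 d mod 71 = (if d = 0 then 0 else 1)"
  unfolding residues_eq upto70 by (simp add: inv71_rules)

text \<open>
  The weights are constant on the orbits of \<open>r \<mapsto> 1 / r\<close> and \<open>r
  \<mapsto> 1 - r\<close>, so that they define a symmetric function of triples.
\<close>

lemma weight_table: "\<forall>r\<in>{0..70}.
    weight (inv71 r) = weight r \<and> weight ((1 - r) mod 71) = weight r"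
  unfolding residues_eq upto70 by (simp add: inv71_rules weight_rules)

text \<open>
  The twelve representatives of the classes of ratios. The six terms are the ratios of the six
  orderings of a triple.
\<close>

lemma representatives: "\<forall>r\<in>{2..70}.
    \<exists>s\<in>{r, inv71 r, (1 - r) mod 71, inv71 ((1 - r) mod 71), (1 - inv71 r) mod 71,
      inv71 ((1 - inv71 r) mod 71)}. s \<in> {3, 4, 5, 6, 2, 7, 8, 16, 17, 21, 22, 23}"
proof -
  have "{2..70::int} = {0..70} - {0,1}" by auto
  then show ?thesis unfolding residues_eq upto70 by (simp add: inv71_rules)
qed

lemma inv71_mod [simp]: "inv71 (d mod 71) = inv71 d"
  by (simp add: inv71_def)

lemma mod_71_range: "(d :: int) mod 71 \<in> {0..70}"
  using pos_mod_bound[of 71 d] pos_mod_sign[of 71 d] by simp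

lemma inv71_range: "0 \<le> inv71 d" "inv71 d < 71"
  using bspec[OF inv71_table mod_71_range[of d]] by simp_all

lemma inv71_zero: "71 dvd d \<Longrightarrow> inv71 d = 0"
  using inv71_mod[of d] by (simp add: inv71_rules)

lemma inv71_mult:
  assumes "\<not> 71 dvd d"
  shows "[d * inv71 d = 1] (mod 71)"
proof -
  have "d mod 71 \<noteq> 0" using assms by (simp add: dvd_eq_mod_eq_0)
  then have "(d mod 71) * inv71 (d mod 71) mod 71 = 1"
    using bspec[OF inv71_table mod_71_range[of d]] by simp
  then show ?thesis by (simp add: cong_def mod_mult_left_eq)
qed

lemma prime_71: "prime (71::int)"
  by simp

lemma inv71_unique:
  assumes "[d * k = 1] (mod 71)"
  shows "[k = inv71 d] (mod 71)"
proof -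
  have nd: "\<not> 71 dvd d"
  proof
    assume "71 dvd d"
    then have "[d * k = 0] (mod 71)" by (simp add: cong_0_iff)
    then have "[1 = 0] (mod (71::int))" using assms cong_sym cong_trans by blast
    then show False by (simp add: cong_def)
  qed
  then have "coprime d 71" using prime_71 by (metis coprime_commute prime_imp_coprime)
  moreover have "[d * k = d * inv71 d] (mod 71)"
    using assms inv71_mult[OF nd] cong_sym cong_trans by blast
  ultimately show ?thesis by (simp add: cong_mult_lcancel)
qed

lemma inv71_scale:
  assumes "\<not> 71 dvd u"
  shows "[u * inv71 (u * d) = inv71 d] (mod 71)"
proof (cases "71 dvd d")
  case True
  then show ?thesis by (simp add: inv71_zero)
next
  case False
  then have "\<not> 71 dvd u * d" using assms prime_71 by (simp add: prime_dvd_mult_iff)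
  then have "[d * (u * inv71 (u * d)) = 1] (mod 71)"
    using inv71_mult[of "u * d"] by (simp add: mult_ac)
  then show ?thesis by (rule inv71_unique)
qed

lemma ratio_range: "ratio x y z \<in> {0..70}"
  unfolding ratio_def by (rule mod_71_range)

lemma ratio_cong:
  "[ratio x y z = (z - x) * inv71 (y - x)] (mod 71)"
  by (simp add: ratio_def cong_def)

lemma cong_range_eq:
  assumes "[r = s] (mod (71::int))" "r \<in> {0..70}" "s \<in> {0..70}"
  shows "r = s"
  using assms by (auto simp: cong_def)

lemma ratio_affine:
  assumes u: "\<not> 71 dvd u" and "[x' = u * x + v] (mod 71)" "[y' = u * y + v] (mod 71)"
    "[z' = u * z + v] (mod 71)"
  shows "ratio x' y' z' = ratio x y z"
proof (rule cong_range_eq)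
  have zx: "[z' - x' = u * (z - x)] (mod 71)" and yx: "[y' - x' = u * (y - x)] (mod 71)"
    using cong_diff[OF assms(4,2)] cong_diff[OF assms(3,2)] by (simp_all add: algebra_simps)
  have "inv71 (y' - x') = inv71 (u * (y - x))"
    using yx inv71_mod unfolding cong_def by metis
  then have "[(z' - x') * inv71 (y' - x') = u * (z - x) * inv71 (u * (y - x))] (mod 71)"
    using cong_mult[OF zx cong_refl] by metis
  also have "u * (z - x) * inv71 (u * (y - x)) = (z - x) * (u * inv71 (u * (y - x)))"
    by (simp add: mult_ac)
  also have "[\<dots> = (z - x) * inv71 (y - x)] (mod 71)"
    using cong_mult[OF cong_refl inv71_scale[OF u]] .
  finally show "[ratio x' y' z' = ratio x y z] (mod 71)"
    using ratio_cong cong_sym cong_trans by blast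
qed (rule ratio_range)+

lemma ratio_eq_0: "71 dvd y - x \<or> 71 dvd z - x \<Longrightarrow> ratio x y z = 0"
  by (auto simp: ratio_def inv71_zero)

lemma ratio_swap_yz:
  "ratio x z y = inv71 (ratio x y z)"
proof (cases "71 dvd y - x \<or> 71 dvd z - x")
  case True
  then have "ratio x y z = 0" "ratio x z y = 0" using ratio_eq_0 by blast+
  then show ?thesis by (simp add: inv71_zero)
next
  case False
  define a b where "a = y - x" and "b = z - x"
  have ab: "[a * inv71 a = 1] (mod 71)" "[b * inv71 b = 1] (mod 71)"
    using False inv71_mult by (auto simp: a_def b_def)
  have "[ratio x y z * ratio x z y = (b * inv71 a) * (a * inv71 b)] (mod 71)"
    using cong_mult[OF ratio_cong ratio_cong] by (simp add: a_def b_def)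
  also have "(b * inv71 a) * (a * inv71 b) = (a * inv71 a) * (b * inv71 b)" by (simp add: mult_ac)
  also have "[\<dots> = 1 * 1] (mod 71)" using cong_mult[OF ab] .
  finally have "[ratio x z y = inv71 (ratio x y z)] (mod 71)"
    using inv71_unique by simp
  then show ?thesis using cong_range_eq ratio_range inv71_range[of "ratio x y z"] by auto
qed

lemma ratio_swap_xy:
  assumes "\<not> 71 dvd y - x"
  shows "ratio y x z = (1 - ratio x y z) mod 71"
proof (rule cong_range_eq)
  define a b where "a = y - x" and "b = z - x"
  have "inv71 (x - y) = inv71 (- 1 * a)" by (simp add: a_def)
  moreover have "[- 1 * inv71 (- 1 * a) = inv71 a] (mod 71)" by (rule inv71_scale) simp
  ultimately have i: "[- inv71 (x - y) = inv71 a] (mod 71)" by simp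
  have "[(z - y) * inv71 (x - y) = (a - b) * (- inv71 (x - y))] (mod 71)"
    by (simp add: a_def b_def algebra_simps)
  also have "[(a - b) * (- inv71 (x - y)) = (a - b) * inv71 a] (mod 71)"
    using cong_mult[OF cong_refl i] .
  also have "(a - b) * inv71 a = a * inv71 a - b * inv71 a" by (simp add: algebra_simps)
  also have "[\<dots> = 1 - ratio x y z] (mod 71)"
    using cong_diff[OF inv71_mult[of a] cong_sym[OF ratio_cong]] assms by (simp add: a_def b_def)
  finally show "[ratio y x z = (1 - ratio x y z) mod 71] (mod 71)"
    using ratio_cong[of y x z] cong_trans by (simp add: cong_def)
qed (rule ratio_range mod_71_range)+

lemma wt_swap_yz: "wt x z y = wt x y z"
  unfolding wt_def ratio_swap_yz[of x z y] using bspec[OF weight_table ratio_range] by blast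

lemma wt_swap_xy: "wt y x z = wt x y z"
proof (cases "71 dvd y - x")
  case True
  then have "71 dvd x - y" by (simp add: dvd_diff_commute)
  with True show ?thesis by (simp add: wt_def ratio_eq_0)
next
  case False
  then show ?thesis
    unfolding wt_def ratio_swap_xy[OF False] using bspec[OF weight_table ratio_range] by blast
qed

lemma wt_same: "wt x x z = 0" "wt x y x = 0" "wt x y y = 0"
proof -
  show xy: "wt x x z = 0" "wt x y x = 0" for x y z
    by (simp_all add: wt_def ratio_eq_0 weight_rules)
  show "wt x y y = 0"
    using xy(2) wt_swap_xy by metis
qed

text \<open>
  The invariant that governs the colour. The sum runs over all ordered triples, and degenerate
  triples contribute 0. So every triple of elements is counted six times, and after the division
  by 3 twice; an even value leaves room for the half weights in the definition of
  \<open>entry\<close>.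
\<close>

definition hash :: "int set \<Rightarrow> int" where
  "hash S = (\<Sum>x\<in>S. \<Sum>y\<in>S. \<Sum>z\<in>S. wt x y z) div 3"

lemma hash_5:
  assumes "distinct [a, b, c, d, e]"
  shows "hash {a, b, c, d, e} = 2 * (wt a b c + wt a b d + wt a b e + wt a c d + wt a c e
    + wt a d e + wt b c d + wt b c e + wt b d e + wt c d e)"
  using assms by (simp add: hash_def wt_same wt_swap_xy wt_swap_yz)

text \<open>
  The additive energy: the number of solutions of \<open>x + y = z + w\<close> in
  \<open>S\<close>.
\<close>

definition energy :: "int set \<Rightarrow> int" where
  "energy S = (\<Sum>x\<in>S. \<Sum>y\<in>S. \<Sum>z\<in>S. if (x + y - z) mod 71 \<in> S then 1 else 0)"

text \<open>
  The affine map \<open>x \<mapsto> u x + v\<close> modulo 71, with values in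
  \<open>{0..70}\<close>.
\<close>

definition affine :: "int \<Rightarrow> int \<Rightarrow> int \<Rightarrow> int" where
  "affine u v x = (u * x + v) mod 71"

lemma affine_cong: "[affine u v x = u * x + v] (mod 71)"
  by (simp add: affine_def cong_def)

lemma affine_range: "affine u v x \<in> {0..70}"
  unfolding affine_def by (rule mod_71_range)

lemma inj_on_affine:
  assumes "\<not> 71 dvd u"
  shows "inj_on (affine u v) {0..70}"
proof (rule inj_onI)
  fix x y assume xy: "x \<in> {0..70::int}" "y \<in> {0..70}" "affine u v x = affine u v y"
  then have "[u * x + v = u * y + v] (mod 71)" by (simp add: affine_def cong_def)
  then have "[u * x = u * y] (mod 71)" by (simp add: cong_add_rcancel)
  moreover have "coprime u 71" using assms prime_71 by (metis coprime_commute prime_imp_coprime)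
  ultimately have "[x = y] (mod 71)" by (simp add: cong_mult_lcancel)
  then show "x = y" using xy cong_range_eq by blast
qed

lemma wt_affine:
  assumes "\<not> 71 dvd u"
  shows "wt (affine u v x) (affine u v y) (affine u v z) = wt x y z"
  unfolding wt_def using ratio_affine[OF assms] by (simp add: affine_def cong_def)

lemma hash_affine:
  assumes "\<not> 71 dvd u" "S \<subseteq> {0..70}"
  shows "hash (affine u v ` S) = hash S"
proof -
  have "inj_on (affine u v) S" using inj_on_affine assms inj_on_subset by blast
  then show ?thesis by (simp add: hash_def sum.reindex wt_affine[OF assms(1)])
qed

lemma energy_affine:
  assumes "\<not> 71 dvd u" "S \<subseteq> {0..70}"
  shows "energy (affine u v ` S) = energy S"
proof -
  have inj: "inj_on (affine u v) S" using inj_on_affine assms inj_on_subset by blast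
  have "(affine u v x + affine u v y - affine u v z) mod 71 \<in> affine u v ` S \<longleftrightarrow>
        (x + y - z) mod 71 \<in> S" for x y z
  proof -
    have "[affine u v x + affine u v y - affine u v z = u * x + v + (u * y + v) - (u * z + v)] (mod 71)"
      using cong_diff[OF cong_add[OF affine_cong affine_cong] affine_cong] .
    also have "u * x + v + (u * y + v) - (u * z + v) = u * (x + y - z) + v"
      by (simp add: algebra_simps)
    also have "[\<dots> = u * ((x + y - z) mod 71) + v] (mod 71)"
      by (rule cong_add[OF cong_mult[OF cong_refl] cong_refl]) (simp add: cong_def)
    finally have "(affine u v x + affine u v y - affine u v z) mod 71 = affine u v ((x + y - z) mod 71)"
      unfolding cong_def affine_def .
    then show ?thesis
      using inj_on_image_mem_iff[OF inj_on_affine[OF assms(1)] mod_71_range assms(2)] by simp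
  qed
  then show ?thesis by (simp only: energy_def sum.reindex[OF inj] o_def)
qed

lemma obtain_sorted_3:
  assumes "card (A :: int set) = 3"
  obtains b c d where "A = {b, c, d}" "b < c" "c < d"
proof -
  have fin: "finite A" using assms card.infinite by fastforce
  define xs where "xs = sorted_list_of_set A"
  have xs: "length xs = 3" "sorted xs" "distinct xs" "set xs = A"
    using fin assms by (simp_all add: xs_def)
  then obtain b c d where "xs = [b, c, d]"
    by (auto simp: numeral_3_eq_3 length_Suc_conv)
  show thesis
  proof (rule that)
    show "A = {b, c, d}" using xs(4) \<open>xs = [b, c, d]\<close> by simp
    show "b < c" "c < d" using xs(2,3) \<open>xs = [b, c, d]\<close> by simp_all
  qed
qed

section \<open>The verification procedure and its soundness\<close>

text \<open>
  The red and the blue hash values in ascending order. They are split into short pieces only to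
  keep terms shallow.
\<close>

definition red_chunks :: "int list list" where
  "red_chunks = [
    [4284, 6170, 6926, 7100, 7386, 7398, 7650, 8072, 8112, 8140, 8282, 8342, 8386, 8872],
    [8888, 9016, 9018, 9062, 9066, 9252, 9304, 9366, 9482, 9704, 9738, 9782, 9862, 9956],
    [9968, 10002, 10090, 10202, 10238, 10314, 10412, 10424, 10474, 10700, 10712, 10952, 10968, 11146],
    [11170, 11316, 11342, 11392, 11452, 11492, 11532, 11658, 11668, 11748, 11802, 11804, 11872, 11886],
    [11916, 11926, 11944, 11986, 12026, 12034, 12080, 12156, 12322, 12340, 12360, 12384, 12462, 12472],
    [12598, 12640, 12658, 12662, 12718, 12720, 12744, 12778, 12820, 12860, 12868, 12872, 12908, 12960],
    [12978, 12980, 12990, 13008, 13060, 13086, 13186, 13208, 13210, 13220, 13254, 13278, 13312, 13328],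
    [13336, 13338, 13400, 13486, 13500, 13514, 13522, 13540, 13548, 13556, 13590, 13596, 13602, 13616],
    [13626, 13650, 13668, 13780, 13786, 13792, 13798, 13878, 13886, 13896, 13898, 13938, 13950, 13976],
    [13992, 14004, 14028, 14034, 14040, 14042, 14048, 14050, 14058, 14128, 14150, 14192, 14240, 14242],
    [14282, 14286, 14294, 14300, 14328, 14332, 14350, 14384, 14432, 14498, 14512, 14516, 14530, 14532],
    [14550, 14558, 14562, 14588, 14592, 14646, 14660, 14680, 14702, 14722, 14750, 14774, 14786, 14812],
    [14832, 14884, 14886, 14898, 14908, 14918, 14920, 14924, 14946, 14980, 15018, 15020, 15022, 15032],
    [15048, 15052, 15078, 15092, 15100, 15104, 15214, 15220, 15232, 15234, 15236, 15244, 15246, 15250],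
    [15256, 15268, 15288, 15320, 15322, 15352, 15364, 15372, 15408, 15410, 15422, 15436, 15438, 15462],
    [15510, 15512, 15544, 15564, 15604, 15612, 15618, 15626, 15628, 15632, 15650, 15664, 15676, 15690],
    [15692, 15714, 15726, 15730, 15734, 15790, 15808, 15814, 15818, 15820, 15838, 15876, 15884, 15912],
    [15930, 15940, 15942, 15944, 15958, 15982, 15988, 15992, 15994, 16002, 16030, 16032, 16064, 16070],
    [16072, 16080, 16158, 16160, 16172, 16192, 16210, 16244, 16268, 16278, 16314, 16330, 16336, 16342],
    [16370, 16378, 16384, 16398, 16408, 16422, 16438, 16440, 16460, 16474, 16482, 16484, 16510, 16518],
    [16526, 16548, 16554, 16562, 16594, 16600, 16608, 16624, 16638, 16640, 16660, 16662, 16670, 16678],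
    [16682, 16708, 16716, 16750, 16774, 16778, 16788, 16790, 16796, 16802, 16804, 16810, 16812, 16818],
    [16824, 16826, 16828, 16834, 16846, 16862, 16864, 16892, 16914, 16944, 16962, 16970, 16982, 16988],
    [16992, 16998, 17010, 17012, 17040, 17052, 17080, 17084, 17090, 17098, 17114, 17132, 17138, 17158],
    [17200, 17202, 17220, 17238, 17250, 17256, 17268, 17296, 17298, 17318, 17322, 17330, 17356, 17362],
    [17364, 17374, 17442, 17498, 17512, 17556, 17562, 17574, 17592, 17598, 17628, 17634, 17640, 17646],
    [17648, 17654, 17660, 17678, 17686, 17700, 17702, 17720, 17746, 17758, 17760, 17762, 17770, 17782],
    [17784, 17800, 17822, 17824, 17832, 17850, 17864, 17870, 17882, 17890, 17898, 17916, 17918, 17934],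
    [17940, 17946, 17956, 17960, 17976, 17998, 18062, 18074, 18088, 18096, 18124, 18132, 18138, 18152],
    [18156, 18172, 18204, 18210, 18212, 18220, 18226, 18228, 18240, 18244, 18250, 18264, 18288, 18334],
    [18338, 18342, 18350, 18382, 18384, 18388, 18390, 18392, 18408, 18420, 18430, 18466, 18484, 18490],
    [18502, 18522, 18548, 18550, 18552, 18582, 18608, 18626, 18630, 18632, 18634, 18636, 18666, 18668],
    [18676, 18690, 18716, 18730, 18738, 18786, 18810, 18864, 18866, 18878, 18882, 18918, 18938, 18942],
    [18950, 19006, 19010, 19012, 19018, 19022, 19026, 19030, 19038, 19046, 19050, 19062, 19094, 19110],
    [19124, 19134, 19138, 19144, 19152, 19154, 19162, 19200, 19202, 19214, 19252, 19282, 19292, 19308],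
    [19326, 19336, 19344, 19356, 19364, 19382, 19390, 19408, 19432, 19450, 19472, 19484, 19496, 19526],
    [19542, 19548, 19554, 19582, 19588, 19614, 19650, 19660, 19680, 19702, 19722, 19726, 19728, 19734],
    [19738, 19742, 19746, 19758, 19764, 19786, 19796, 19798, 19804, 19816, 19822, 19846, 19854, 19866],
    [19868, 19876, 19878, 19908, 19912, 19920, 19942, 19946, 19996, 20000, 20002, 20014, 20026, 20038],
    [20072, 20080, 20082, 20100, 20102, 20108, 20112, 20128, 20136, 20138, 20146, 20150, 20164, 20168],
    [20180, 20188, 20204, 20206, 20220, 20252, 20254, 20258, 20280, 20282, 20294, 20304, 20316, 20354],
    [20358, 20378, 20386, 20404, 20414, 20422, 20424, 20440, 20452, 20468, 20474, 20486, 20494, 20506],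
    [20510, 20538, 20546, 20550, 20552, 20564, 20570, 20580, 20584, 20602, 20618, 20634, 20664, 20676],
    [20678, 20684, 20694, 20730, 20760, 20768, 20778, 20790, 20794, 20800, 20818, 20822, 20828, 20834],
    [20836, 20846, 20856, 20860, 20874, 20878, 20908, 20934, 20942, 20946, 20956, 20974, 20986, 20992],
    [21030, 21034, 21040, 21046, 21050, 21058, 21064, 21066, 21096, 21100, 21112, 21116, 21134, 21144],
    [21150, 21188, 21198, 21204, 21208, 21210, 21218, 21228, 21234, 21254, 21262, 21264, 21276, 21300],
    [21306, 21328, 21332, 21340, 21372, 21378, 21384, 21386, 21390, 21402, 21414, 21418, 21424, 21426],
    [21434, 21438, 21454, 21460, 21462, 21464, 21474, 21500, 21510, 21532, 21548, 21560, 21564, 21566],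
    [21574, 21578, 21580, 21586, 21610, 21632, 21638, 21648, 21668, 21680, 21724, 21734, 21742, 21744],
    [21760, 21768, 21772, 21784, 21790, 21810, 21812, 21822, 21840, 21844, 21848, 21854, 21858, 21878],
    [21908, 21912, 21944, 21956, 21958, 21964, 21974, 21990, 21992, 21996, 21998, 22004, 22024, 22026],
    [22032, 22042, 22046, 22048, 22054, 22062, 22068, 22082, 22086, 22114, 22132, 22168, 22212, 22216],
    [22224, 22240, 22242, 22260, 22272, 22278, 22298, 22306, 22310, 22336, 22344, 22354, 22368, 22370],
    [22376, 22378, 22398, 22418, 22442, 22454, 22456, 22462, 22464, 22474, 22500, 22508, 22510, 22516],
    [22528, 22538, 22540, 22550, 22554, 22556, 22558, 22566, 22584, 22606, 22616, 22618, 22620, 22622],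
    [22628, 22644, 22648, 22664, 22702, 22718, 22738, 22744, 22756, 22764, 22774, 22798, 22822, 22830],
    [22848, 22860, 22870, 22876, 22890, 22894, 22904, 22910, 22940, 22948, 22968, 23000, 23008, 23022],
    [23024, 23026, 23036, 23044, 23048, 23076, 23096, 23120, 23138, 23148, 23160, 23168, 23202, 23214],
    [23234, 23246, 23268, 23290, 23308, 23312, 23318, 23348, 23352, 23356, 23380, 23390, 23400, 23410],
    [23418, 23440, 23446, 23456, 23460, 23464, 23476, 23494, 23498, 23530, 23532, 23626, 23640, 23652],
    [23656, 23660, 23672, 23676, 23680, 23720, 23750, 23752, 23784, 23792, 23808, 23810, 23816, 23838],
    [23844, 23854, 23890, 23900, 23942, 23946, 23952, 23956, 23958, 23962, 23974, 23980, 23994, 24004],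
    [24018, 24024, 24044, 24046, 24052, 24084, 24096, 24114, 24118, 24150, 24160, 24224, 24228, 24230],
    [24244, 24262, 24306, 24310, 24312, 24318, 24322, 24324, 24336, 24338, 24400, 24426, 24428, 24446],
    [24476, 24488, 24602, 24622, 24630, 24636, 24666, 24682, 24718, 24740, 24748, 24768, 24814, 24820],
    [24824, 24872, 24886, 24894, 24896, 24908, 24910, 24936, 24946, 24984, 25030, 25056, 25060, 25068],
    [25086, 25124, 25146, 25168, 25204, 25210, 25212, 25222, 25224, 25232, 25238, 25240, 25254, 25316],
    [25320, 25328, 25346, 25350, 25388, 25390, 25426, 25478, 25484, 25506, 25528, 25536, 25558, 25568],
    [25584, 25590, 25608, 25612, 25644, 25650, 25656, 25666, 25706, 25734, 25742, 25754, 25756, 25796],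
    [25838, 25862, 25868, 25888, 25910, 25916, 25932, 25952, 25954, 26000, 26030, 26038, 26078, 26144],
    [26148, 26168, 26188, 26216, 26234, 26246, 26248, 26294, 26296, 26316, 26322, 26326, 26352, 26358],
    [26392, 26412, 26458, 26462, 26464, 26500, 26510, 26552, 26570, 26596, 26606, 26638, 26742, 26780],
    [26794, 26816, 26824, 26868, 26888, 26918, 26936, 26950, 27014, 27020, 27100, 27108, 27134, 27162],
    [27192, 27230, 27260, 27284, 27364, 27404, 27424, 27686, 27698, 27746, 27850, 27912, 27932, 27958],
    [27980, 28024, 28068, 28084, 28116, 28164, 28338, 28522, 28596, 28634, 28680, 28830, 28840, 28990],
    [29008, 29020, 29054, 29214, 29226, 29258, 29418, 29470, 29476, 29660, 29688, 29712, 29790, 29802],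
    [30142, 30356, 30370, 30380, 30432, 30626, 30784, 30914, 30920, 31032, 31988, 31998, 32106, 32460],
    [32572, 32670]]"

definition blue_chunks :: "int list list" where
  "blue_chunks = [
    [2972, 7022, 7244, 7770, 7776, 7854, 8260, 8542, 8568, 8976, 9036, 9210, 9258, 9348],
    [9522, 9530, 9806, 10096, 10222, 10244, 10302, 10312, 10356, 10394, 10490, 10530, 10544, 10596],
    [10682, 10742, 10880, 11030, 11050, 11132, 11162, 11186, 11262, 11402, 11440, 11468, 11472, 11484],
    [11486, 11556, 11606, 11614, 11634, 11654, 11744, 11876, 11896, 12036, 12120, 12126, 12132, 12182],
    [12188, 12214, 12224, 12264, 12342, 12374, 12448, 12516, 12524, 12582, 12612, 12636, 12672, 12686],
    [12706, 12716, 12726, 12730, 12768, 12796, 12834, 12856, 12864, 12902, 12926, 12950, 12986, 13026],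
    [13058, 13064, 13080, 13118, 13122, 13132, 13134, 13138, 13162, 13184, 13226, 13228, 13288, 13318],
    [13326, 13348, 13442, 13568, 13636, 13648, 13664, 13694, 13700, 13706, 13718, 13738, 13752, 13756],
    [13782, 13800, 13804, 13850, 13852, 13860, 13916, 13930, 13936, 13954, 13964, 13988, 13998, 14012],
    [14024, 14026, 14052, 14098, 14134, 14166, 14198, 14218, 14252, 14292, 14306, 14330, 14336, 14340],
    [14348, 14352, 14356, 14370, 14390, 14412, 14420, 14452, 14484, 14496, 14542, 14552, 14560, 14566],
    [14584, 14652, 14670, 14704, 14706, 14714, 14734, 14736, 14742, 14772, 14778, 14788, 14796, 14798],
    [14804, 14810, 14820, 14850, 14852, 14854, 14870, 14890, 14906, 14912, 14926, 14944, 14950, 14952],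
    [14960, 14972, 14982, 15064, 15066, 15110, 15128, 15134, 15144, 15146, 15178, 15190, 15258, 15260],
    [15264, 15266, 15318, 15328, 15464, 15478, 15498, 15508, 15518, 15560, 15570, 15572, 15586, 15594],
    [15620, 15634, 15642, 15662, 15704, 15710, 15754, 15776, 15788, 15796, 15832, 15834, 15878, 15882],
    [15890, 15898, 15908, 15928, 15948, 15956, 15978, 15986, 16018, 16068, 16082, 16106, 16120, 16130],
    [16140, 16142, 16154, 16156, 16162, 16212, 16222, 16234, 16242, 16256, 16264, 16270, 16332, 16348],
    [16352, 16358, 16372, 16428, 16432, 16446, 16456, 16480, 16490, 16532, 16542, 16550, 16648, 16656],
    [16676, 16696, 16718, 16722, 16728, 16742, 16758, 16760, 16782, 16800, 16820, 16840, 16868, 16870],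
    [16874, 16888, 16900, 16910, 16924, 16930, 16934, 16974, 16978, 17032, 17056, 17058, 17082, 17128],
    [17140, 17154, 17164, 17178, 17198, 17226, 17236, 17260, 17292, 17316, 17348, 17352, 17376, 17380],
    [17386, 17400, 17418, 17448, 17454, 17470, 17472, 17484, 17488, 17528, 17536, 17540, 17548, 17552],
    [17568, 17582, 17584, 17588, 17590, 17596, 17618, 17630, 17632, 17636, 17638, 17650, 17658, 17662],
    [17682, 17692, 17694, 17698, 17704, 17710, 17724, 17740, 17764, 17792, 17804, 17806, 17810, 17812],
    [17814, 17844, 17848, 17852, 17862, 17868, 17876, 17894, 17896, 17906, 17936, 17950, 17968, 17970],
    [17980, 17992, 17994, 18008, 18022, 18032, 18038, 18042, 18058, 18078, 18086, 18094, 18098, 18100],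
    [18114, 18126, 18128, 18134, 18148, 18162, 18180, 18182, 18192, 18202, 18230, 18246, 18248, 18270],
    [18278, 18280, 18286, 18294, 18302, 18308, 18330, 18346, 18352, 18368, 18378, 18380, 18386, 18434],
    [18436, 18438, 18448, 18450, 18452, 18468, 18496, 18504, 18510, 18518, 18528, 18530, 18546, 18558],
    [18564, 18570, 18584, 18594, 18618, 18620, 18622, 18638, 18662, 18664, 18672, 18692, 18698, 18726],
    [18728, 18772, 18780, 18794, 18812, 18834, 18840, 18842, 18858, 18914, 18920, 18922, 18926, 18940],
    [18968, 18984, 18994, 18998, 19004, 19016, 19024, 19034, 19044, 19048, 19058, 19060, 19070, 19076],
    [19086, 19106, 19118, 19120, 19132, 19140, 19156, 19168, 19176, 19178, 19180, 19188, 19190, 19224],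
    [19236, 19262, 19272, 19274, 19276, 19302, 19312, 19314, 19332, 19338, 19348, 19366, 19388, 19402],
    [19424, 19430, 19436, 19448, 19454, 19466, 19474, 19476, 19482, 19486, 19498, 19500, 19520, 19532],
    [19536, 19544, 19552, 19560, 19562, 19566, 19578, 19596, 19616, 19624, 19628, 19640, 19656, 19672],
    [19690, 19696, 19716, 19718, 19732, 19736, 19744, 19748, 19760, 19766, 19780, 19808, 19810, 19820],
    [19834, 19838, 19852, 19884, 19886, 19894, 19926, 19930, 19948, 19950, 19952, 19954, 19964, 19970],
    [19982, 19984, 19992, 20004, 20012, 20024, 20028, 20032, 20042, 20058, 20074, 20092, 20094, 20098],
    [20116, 20132, 20154, 20156, 20176, 20178, 20190, 20194, 20202, 20216, 20230, 20234, 20242, 20244],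
    [20260, 20276, 20298, 20306, 20308, 20336, 20338, 20342, 20344, 20346, 20352, 20368, 20370, 20372],
    [20384, 20392, 20394, 20400, 20402, 20410, 20412, 20420, 20430, 20436, 20444, 20464, 20470, 20504],
    [20512, 20524, 20572, 20574, 20582, 20590, 20606, 20610, 20614, 20632, 20652, 20656, 20662, 20704],
    [20706, 20716, 20718, 20720, 20732, 20740, 20770, 20824, 20842, 20844, 20858, 20866, 20868, 20894],
    [20940, 20944, 20996, 21006, 21012, 21016, 21022, 21024, 21048, 21052, 21088, 21090, 21098, 21102],
    [21106, 21130, 21136, 21142, 21158, 21162, 21170, 21174, 21178, 21212, 21222, 21250, 21260, 21268],
    [21274, 21320, 21338, 21364, 21368, 21370, 21394, 21396, 21408, 21416, 21422, 21442, 21448, 21458],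
    [21478, 21512, 21544, 21550, 21570, 21582, 21590, 21634, 21636, 21656, 21662, 21694, 21714, 21720],
    [21722, 21726, 21732, 21738, 21774, 21794, 21796, 21814, 21816, 21824, 21828, 21842, 21846, 21850],
    [21856, 21862, 21866, 21870, 21884, 21896, 21902, 21924, 21934, 21946, 21948, 21950, 21962, 21966],
    [21970, 22006, 22014, 22028, 22044, 22064, 22066, 22072, 22078, 22112, 22128, 22130, 22134, 22148],
    [22170, 22184, 22192, 22198, 22210, 22214, 22236, 22246, 22266, 22284, 22300, 22328, 22330, 22350],
    [22364, 22382, 22402, 22404, 22470, 22492, 22498, 22524, 22562, 22586, 22592, 22632, 22652, 22666],
    [22668, 22670, 22676, 22684, 22686, 22698, 22760, 22792, 22800, 22810, 22828, 22832, 22846, 22850],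
    [22866, 22878, 22882, 22908, 22924, 22930, 22938, 22960, 22964, 22976, 22984, 22988, 22990, 23010],
    [23020, 23092, 23100, 23102, 23116, 23150, 23156, 23172, 23190, 23196, 23204, 23212, 23222, 23224],
    [23242, 23252, 23258, 23264, 23278, 23280, 23296, 23298, 23300, 23302, 23314, 23322, 23326, 23338],
    [23344, 23368, 23372, 23384, 23386, 23394, 23404, 23444, 23482, 23502, 23512, 23520, 23528, 23556],
    [23588, 23594, 23616, 23632, 23634, 23670, 23686, 23690, 23702, 23706, 23764, 23766, 23772, 23776],
    [23786, 23806, 23818, 23820, 23842, 23860, 23862, 23864, 23894, 23910, 23914, 23916, 23922, 23938],
    [23950, 23954, 23964, 23988, 23992, 24002, 24014, 24022, 24038, 24078, 24090, 24172, 24176, 24206],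
    [24220, 24254, 24272, 24308, 24342, 24344, 24372, 24404, 24408, 24452, 24462, 24474, 24494, 24504],
    [24516, 24522, 24524, 24556, 24570, 24586, 24626, 24628, 24658, 24670, 24672, 24680, 24684, 24722],
    [24734, 24744, 24756, 24786, 24834, 24876, 24882, 24890, 24898, 24904, 24914, 24924, 24928, 24954],
    [25004, 25012, 25014, 25054, 25080, 25092, 25116, 25120, 25130, 25182, 25200, 25214, 25218, 25274],
    [25304, 25344, 25382, 25384, 25400, 25414, 25434, 25486, 25490, 25532, 25534, 25542, 25544, 25546],
    [25560, 25588, 25614, 25626, 25632, 25684, 25712, 25748, 25758, 25788, 25822, 25850, 25864, 25874],
    [25882, 25902, 25914, 25944, 25994, 26016, 26040, 26088, 26096, 26106, 26132, 26134, 26156, 26184],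
    [26204, 26228, 26362, 26380, 26384, 26386, 26390, 26400, 26410, 26432, 26438, 26544, 26568, 26580],
    [26640, 26642, 26670, 26680, 26708, 26714, 26732, 26736, 26760, 26766, 26772, 26908, 26928, 26992],
    [27022, 27056, 27072, 27104, 27156, 27194, 27214, 27264, 27278, 27332, 27398, 27410, 27476, 27512],
    [27536, 27552, 27580, 27612, 27622, 27720, 27776, 27804, 27808, 27834, 27840, 27848, 27862, 27950],
    [28086, 28110, 28118, 28150, 28158, 28192, 28224, 28228, 28232, 28366, 28408, 28468, 28546, 28716],
    [28728, 28744, 28778, 28788, 28808, 29012, 29066, 29770, 29792, 29904, 29940, 30102, 30504, 30682],
    [30820, 30994, 31042, 31170, 31174, 31322, 31676, 32434]]"

text \<open>
  The hue of a hash value. Grey hash values do not determine a colour; 15276 is the only hash of a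
  5-set that is grey.
\<close>

datatype hue = Red | Blue | Grey

definition hue :: "int \<Rightarrow> hue" where
  "hue n = (if n \<in> set (concat red_chunks) then Red
    else if n \<in> set (concat blue_chunks) then Blue else Grey)"

text \<open>Two hues clash if one is red and the other blue.\<close>

fun clash :: "hue \<Rightarrow> hue \<Rightarrow> bool" where
  "clash Red Red = False" | "clash Red Blue = True" | "clash Red Grey = False"
| "clash Blue Red = True" | "clash Blue Blue = False" | "clash Blue Grey = False"
| "clash Grey Red = False" | "clash Grey Blue = False" | "clash Grey Grey = False"

text \<open>The combination of two hues that do not clash; grey is neutral.\<close>

fun join :: "hue \<Rightarrow> hue \<Rightarrow> hue" where
  "join Red k = Red" | "join Blue k = Blue" | "join Grey k = k"

text \<open>
  Weights of triples containing 0. The verification only evaluates \<open>wt0 d e\<close> for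
  \<open>0 < d < e \<le> 70\<close>, which needs one precomputed table; \<open>swt\<close> reduces
  an arbitrary triple to this case by sorting it.
\<close>

definition wt0 :: "int \<Rightarrow> int \<Rightarrow> int" where "wt0 d e = wt 0 d e"

definition swt :: "int \<Rightarrow> int \<Rightarrow> int \<Rightarrow> int" where
  "swt x y z =
    (if x < y then if y < z then wt0 (y - x) (z - x)
        else if x < z then wt0 (z - x) (y - x) else wt0 (x - z) (y - z)
     else if x < z then wt0 (x - y) (z - y)
        else if y < z then wt0 (z - y) (x - y) else wt0 (y - z) (x - z))"

text \<open>
  The edges of the graph for a fixed \<open>t\<close>. An edge carries the hue of \<open>{0, 1, t,
  b, c}\<close> and the shares of the pair \<open>b, c\<close> in the hashes of \<open>{0, 1, b,
  c, d}\<close>, \<open>{0, t, b, c, d}\<close> and \<open>{1, t, b, c, d}\<close>.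
\<close>

datatype entry = No_Edge | Edge hue int int int

text \<open>
  The entry for the pair \<open>b, c\<close>, where \<open>m = wt 0 1 t\<close>. A triple formed
  by \<open>b, c\<close> and one of \<open>0, 1, t\<close> that is lighter than \<open>m\<close>
  deletes the edge. In the hash of \<open>{p, q, b, c, d}\<close>, which is twice the sum of the
  weights, the weight of \<open>p, q, b\<close> is divided equally between the two pairs \<open>b,
  c\<close> and \<open>b, d\<close>; this way the hash is the sum of the shares of the three pairs
  and of \<open>2 * wt b c d\<close>.
\<close>

definition entry :: "int \<Rightarrow> int \<Rightarrow> int \<Rightarrow> int \<Rightarrow> entry" where
  "entry t m b c =
    (if wt0 b c < m then No_Edge
     else if wt0 (b - 1) (c - 1) < m then No_Edge
     else if swt t b c < m then No_Edge
     else Edge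
       (hue (2 * (m + (wt0 1 b + swt 0 t b + swt 1 t b) + (wt0 1 c + swt 0 t c + swt 1 t c)
          + (wt0 b c + wt0 (b - 1) (c - 1) + swt t b c))))
       (2 * (wt0 b c + wt0 (b - 1) (c - 1)) + (wt0 1 b + wt0 1 c))
       (2 * (wt0 b c + swt t b c) + (swt 0 t b + swt 0 t c))
       (2 * (wt0 (b - 1) (c - 1) + swt t b c) + (swt 1 t b + swt 1 t c)))"

type_synonym triples = "(int \<times> int \<times> int) list"

text \<open>
  The test of a triple \<open>b, c, d\<close> looks at the hues of the six 5-subsets of \<open>{0,
  1, t, b, c, d}\<close> one after the other, until two of them clash. In each function the hue
  \<open>k\<close> combines those seen before, and \<open>k'\<close> is the next one. If all six
  are grey, the triple has to be in the list \<open>ex\<close>.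
\<close>

definition test6 :: "triples \<Rightarrow> int \<Rightarrow> int \<Rightarrow> int \<Rightarrow> hue \<Rightarrow> hue \<Rightarrow> bool" where
  "test6 ex b c d k k' = (if clash k k' then True
    else if join k k' = Grey then (b, c, d) \<in> set ex else False)"

definition test5 :: "triples \<Rightarrow> int \<Rightarrow> int \<Rightarrow> int \<Rightarrow> hue \<Rightarrow> hue \<Rightarrow> int \<Rightarrow> bool" where
  "test5 ex b c d k k' w = (if clash k k' then True
    else test6 ex b c d (join k k') (hue w))"

definition test4 :: "triples \<Rightarrow> int \<Rightarrow> int \<Rightarrow> int \<Rightarrow> hue \<Rightarrow> hue \<Rightarrow> int \<Rightarrow> int \<Rightarrow> bool" where
  "test4 ex b c d k k' v w = (if clash k k' then True
    else test5 ex b c d (join k k') (hue v) w)"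

definition test3 :: "triples \<Rightarrow> int \<Rightarrow> int \<Rightarrow> int \<Rightarrow> hue \<Rightarrow> int \<Rightarrow> int \<Rightarrow> int \<Rightarrow> int \<Rightarrow> bool" where
  "test3 ex b c d k m u v w = test4 ex b c d k (hue (u + m)) (v + m) (w + m)"

text \<open>
  \<open>test1\<close> and \<open>test2\<close> add the entries of the second and third edge of
  the triangle to the first.
\<close>

primrec test2 :: "triples \<Rightarrow> int \<Rightarrow> int \<Rightarrow> int \<Rightarrow> hue \<Rightarrow> int \<Rightarrow> int \<Rightarrow> int \<Rightarrow> entry \<Rightarrow> bool" where
  "test2 ex b c d k u v w No_Edge = True"
| "test2 ex b c d k u v w (Edge k' u' v' w') = (if clash k k' then True
    else test3 ex b c d (join k k') (2 * wt0 (c - b) (d - b)) (u + u') (v + v') (w + w'))"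

primrec test1 :: "triples \<Rightarrow> int \<Rightarrow> int \<Rightarrow> int \<Rightarrow> hue \<Rightarrow> int \<Rightarrow> int \<Rightarrow> int \<Rightarrow> entry \<Rightarrow> entry \<Rightarrow> bool" where
  "test1 ex b c d k u v w No_Edge g = True"
| "test1 ex b c d k u v w (Edge k' u' v' w') g = (if clash k k' then True
    else test2 ex b c d (join k k') (u + u') (v + v') (w + w') g)"

text \<open>
  The loops over \<open>d\<close>, \<open>c\<close> and \<open>b\<close>. The rows of entries are
  aligned with the list of points: the row of \<open>b\<close> contains the entries for the points
  after \<open>b\<close>. The loops are conjunctions rather than conditionals because the
  simplifier would traverse the branch of a conditional, with the whole table in it, once more
  after every step.
\<close>

fun walk :: "triples \<Rightarrow> int \<Rightarrow> int \<Rightarrow> hue \<Rightarrow> int \<Rightarrow> int \<Rightarrow> int \<Rightarrow> entry list \<Rightarrow> entry list \<Rightarrow> int list \<Rightarrow> bool" where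
  "walk ex b c k u v w (f # fs) (g # gs) (d # ds) \<longleftrightarrow>
    test1 ex b c d k u v w f g \<and> walk ex b c k u v w fs gs ds"
| "walk ex b c k u v w [] gs ds \<longleftrightarrow> True"
| "walk ex b c k u v w (f # fs) [] ds \<longleftrightarrow> True"
| "walk ex b c k u v w (f # fs) (g # gs) [] \<longleftrightarrow> True"

primrec test_pair :: "triples \<Rightarrow> int \<Rightarrow> int \<Rightarrow> entry \<Rightarrow> entry list \<Rightarrow> entry list \<Rightarrow> int list \<Rightarrow> bool" where
  "test_pair ex b c No_Edge fs gs ds = True"
| "test_pair ex b c (Edge k u v w) fs gs ds = walk ex b c k u v w fs gs ds"

fun test_row :: "triples \<Rightarrow> int \<Rightarrow> entry list \<Rightarrow> entry list list \<Rightarrow> int list \<Rightarrow> bool" where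
  "test_row ex b (e # es) (r # rs) (c # cs) \<longleftrightarrow>
    test_pair ex b c e es r cs \<and> test_row ex b es rs cs"
| "test_row ex b [] rs cs \<longleftrightarrow> True"
| "test_row ex b (e # es) [] cs \<longleftrightarrow> True"
| "test_row ex b (e # es) (r # rs) [] \<longleftrightarrow> True"

fun test_rows :: "triples \<Rightarrow> entry list list \<Rightarrow> int list \<Rightarrow> bool" where
  "test_rows ex (r # rs) (b # bs) \<longleftrightarrow> test_row ex b r rs bs \<and> test_rows ex rs bs"
| "test_rows ex [] bs \<longleftrightarrow> True"
| "test_rows ex (r # rs) [] \<longleftrightarrow> True"

primrec rows :: "int \<Rightarrow> int \<Rightarrow> int list \<Rightarrow> entry list list" where
  "rows t m [] = []"
| "rows t m (b # bs) = map (entry t m b) bs # rows t m bs"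

text \<open>
  The possible points besides \<open>0, 1, t\<close>: no triple formed by \<open>b\<close> and two
  of \<open>0, 1, t\<close> is lighter than \<open>m = wt 0 1 t\<close>.
\<close>

definition admissible :: "int \<Rightarrow> int \<Rightarrow> int \<Rightarrow> bool" where
  "admissible t m b = (if b = t then False else if wt0 1 b < m then False
    else if swt 0 t b < m then False else m \<le> swt 1 t b)"

definition test_points :: "triples \<Rightarrow> int \<Rightarrow> int \<Rightarrow> int list \<Rightarrow> bool" where
  "test_points ex t m bs = test_rows ex (rows t m bs) bs"

text \<open>The whole verification for the representative \<open>t\<close>.\<close>

definition check :: "triples \<Rightarrow> int \<Rightarrow> bool" where
  "check ex t = test_points ex t (wt0 1 t) (filter (admissible t (wt0 1 t)) [2..70])"

lemma wt_eq_wt0: "wt x y z = wt0 (y - x) (z - x)"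
  by (simp add: wt0_def wt_def ratio_def)

lemma swt_eq_wt: "swt x y z = wt x y z"
proof -
  note s = wt_eq_wt0[symmetric]
  show ?thesis unfolding swt_def s by (simp add: wt_swap_xy wt_swap_yz)
qed

text \<open>The test of a single triple as performed by the loops.\<close>

definition test_triple :: "triples \<Rightarrow> int \<Rightarrow> int \<Rightarrow> int \<Rightarrow> int \<Rightarrow> int \<Rightarrow> bool" where
  "test_triple ex t m b c d =
    (case entry t m b c of No_Edge \<Rightarrow> True
     | Edge k u v w \<Rightarrow> test1 ex b c d k u v w (entry t m b d) (entry t m c d))"

lemma walk_iff:
  "walk ex b c k u v w (map f ds) (map g ds) ds \<longleftrightarrow> (\<forall>d\<in>set ds. test1 ex b c d k u v w (f d) (g d))"
  by (induction ds) auto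

lemma test_pair_iff:
  "test_pair ex b c (entry t m b c) (map (entry t m b) ds) (map (entry t m c) ds) ds
    \<longleftrightarrow> (\<forall>d\<in>set ds. test_triple ex t m b c d)"
  by (cases "entry t m b c") (simp_all add: walk_iff test_triple_def)

lemma test_row_iff:
  "test_row ex b (map (entry t m b) cs) (rows t m cs) cs \<longleftrightarrow> sorted_wrt (test_triple ex t m b) cs"
  by (induction cs) (simp_all add: test_pair_iff)

lemma sorted_wrtD:
  assumes "sorted_wrt P xs" "sorted xs" "x \<in> set xs" "y \<in> set xs" "x < (y :: int)"
  shows "P x y"
  using assms by (induction xs) force+

lemma test_pointsD:
  assumes "test_points ex t m bs" "sorted bs" "b \<in> set bs" "c \<in> set bs" "d \<in> set bs"
    "b < c" "c < d"
  shows "test_triple ex t m b c d"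
  using assms unfolding test_points_def
proof (induction bs)
  case (Cons a bs)
  show ?case
  proof (cases "b = a")
    case True
    then have "c \<in> set bs" "d \<in> set bs" using Cons.prems by auto
    moreover have "sorted_wrt (test_triple ex t m a) bs"
      using Cons.prems(1) by (simp add: test_row_iff)
    ultimately show ?thesis using sorted_wrtD Cons.prems True by fastforce
  next
    case False
    then have "b \<in> set bs" "a < b" using Cons.prems by auto
    then show ?thesis using Cons by auto
  qed
qed simp

text \<open>\<open>k\<close> summarises a set of hues without a clash.\<close>

definition summary :: "hue set \<Rightarrow> hue \<Rightarrow> bool" where
  "summary H k \<longleftrightarrow> (Red \<in> H \<longleftrightarrow> k = Red) \<and> (Blue \<in> H \<longleftrightarrow> k = Blue)"

lemma summary_single: "summary {k} k"
  by (cases k) (simp_all add: summary_def)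

lemma summary_join: "summary H k \<Longrightarrow> \<not> clash k k' \<Longrightarrow> summary (insert k' H) (join k k')"
  by (cases k; cases k') (simp_all add: summary_def)

lemma summary_clash: "summary H k \<Longrightarrow> clash k k' \<Longrightarrow> {Red, Blue} \<subseteq> insert k' H"
  by (cases k; cases k') (simp_all add: summary_def)

lemma test4_sound:
  assumes "summary H k" "test4 ex b c d k k' v w"
  shows "{Red, Blue} \<subseteq> {hue w, hue v, k'} \<union> H \<or> (b, c, d) \<in> set ex"
proof (cases "clash k k'")
  case True
  then show ?thesis using summary_clash[OF assms(1)] by blast
next
  case F1: False
  note s1 = summary_join[OF assms(1) F1]
  show ?thesis
  proof (cases "clash (join k k') (hue v)")
    case True
    then show ?thesis using summary_clash[OF s1] by blast
  next
    case F2: False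
    note s2 = summary_join[OF s1 F2]
    show ?thesis
    proof (cases "clash (join (join k k') (hue v)) (hue w)")
      case True
      then show ?thesis using summary_clash[OF s2] by blast
    next
      case False
      then show ?thesis
        using assms(2) F1 F2 by (simp add: test4_def test5_def test6_def split: if_splits)
    qed
  qed
qed

lemma test_hues:
  assumes "\<not> clash k1 k2 \<Longrightarrow> \<not> clash (join k1 k2) k3 \<Longrightarrow>
      test4 ex b c d (join (join k1 k2) k3) (hue u) v w"
  shows "{Red, Blue} \<subseteq> {hue w, hue v, hue u, k3, k2, k1} \<or> (b, c, d) \<in> set ex"
proof (cases "clash k1 k2")
  case True
  then show ?thesis using summary_clash[OF summary_single] by blast
next
  case F1: False
  note s1 = summary_join[OF summary_single F1]
  show ?thesis
  proof (cases "clash (join k1 k2) k3")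
    case True
    then show ?thesis using summary_clash[OF s1] by blast
  next
    case False
    then show ?thesis
      using test4_sound[OF summary_join[OF s1 False] assms[OF F1 False]] by auto
  qed
qed

text \<open>
  A successful check shows that red and blue hashes both occur among the 5-subsets of every
  normalised 6-set outside the list of exceptions.
\<close>

lemma check_sound:
  assumes check: "check ex t" and t: "t \<notin> {0, 1}"
    and ord: "2 \<le> b" "b < c" "c < d" "d \<le> 70" and bcd: "t \<notin> {b, c, d}"
    and min: "\<And>x y z. {x, y, z} \<subseteq> {0, 1, t, b, c, d} \<Longrightarrow> distinct [x, y, z] \<Longrightarrow> wt 0 1 t \<le> wt x y z"
  shows "{Red, Blue} \<subseteq> (\<lambda>a. hue (hash ({0, 1, t, b, c, d} - {a}))) ` {0, 1, t, b, c, d}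
    \<or> (b, c, d) \<in> set ex"
proof -
  define m where "m = wt 0 1 t"
  note shift = swt_eq_wt wt_eq_wt0[symmetric]
  have min3: "m \<le> wt x y z" if "x \<in> {0, 1, t}" "y \<in> {0, 1, t, b, c, d}" "z \<in> {b, c, d}"
    "x \<noteq> y" "y \<noteq> z" for x y z
  proof -
    have "x \<noteq> z" using that(1,3) ord bcd by auto
    then show ?thesis unfolding m_def using that by (intro min) auto
  qed
  have adm: "admissible t m x" if "x \<in> {b, c, d}" for x
  proof -
    have "x \<noteq> t" "x \<noteq> 0" "x \<noteq> 1" using that bcd ord by auto
    then show ?thesis
      using min3[of 0 1 x] min3[of 0 t x] min3[of 1 t x] that t
      unfolding admissible_def shift unfolding wt0_def by simp
  qed
  define bs where "bs = filter (admissible t m) [2..70]"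
  have bs: "sorted bs" "set bs = {x. 2 \<le> x \<and> x \<le> 70 \<and> admissible t m x}"
    unfolding bs_def by (auto simp only: set_filter set_upto sorted_upto sorted_wrt_filter atLeastAtMost_iff)
  have "test_points ex t m bs"
    using check unfolding check_def wt0_def m_def bs_def .
  then have T: "test_triple ex t m b c d"
    by (rule test_pointsD[OF _ bs(1)]) (use adm ord in \<open>simp_all add: bs(2)\<close>)
  \<comment> \<open>the share of the pair \<open>x, y\<close> in the hash of \<open>{p, q, b, c, d}\<close>\<close>
  define U where "U p q x y = 2 * (wt p x y + wt q x y) + (wt p q x + wt p q y)" for p q x y
  have entry: "entry t m x y = Edge (hue (hash {0, 1, t, x, y})) (U 0 1 x y) (U 0 t x y) (U 1 t x y)"
    if "x \<in> {b, c, d}" "y \<in> {b, c, d}" "x < y" for x y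
  proof -
    have "x \<ge> 2" "y \<ge> 2" "x \<noteq> t" "y \<noteq> t" using that ord bcd by auto
    then have "m \<le> wt 0 x y" "m \<le> wt 1 x y" "m \<le> wt t x y"
      using that by (auto intro!: min3)
    moreover have "hash {0, 1, t, x, y} = 2 * (m + (wt 0 1 x + wt 0 t x + wt 1 t x)
        + (wt 0 1 y + wt 0 t y + wt 1 t y) + (wt 0 x y + wt 1 x y + wt t x y))"
      using \<open>x \<ge> 2\<close> \<open>y \<ge> 2\<close> \<open>x \<noteq> t\<close> \<open>y \<noteq> t\<close> \<open>x < y\<close> t by (subst hash_5) (auto simp: m_def)
    ultimately show ?thesis unfolding entry_def shift U_def unfolding wt0_def by simp
  qed
  have *: "{Red, Blue} \<subseteq> {hue (hash {1, t, b, c, d}), hue (hash {0, t, b, c, d}),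
      hue (hash {0, 1, b, c, d}), hue (hash {0, 1, t, c, d}), hue (hash {0, 1, t, b, d}),
      hue (hash {0, 1, t, b, c})} \<or> (b, c, d) \<in> set ex"
  proof -
    have h: "hash {x, y, b, c, d} = U x y b c + U x y b d + U x y c d + 2 * wt b c d"
      if "x \<in> {0, 1, t}" "y \<in> {0, 1, t}" "x \<noteq> y" for x y
    proof -
      have "distinct [x, y, b, c, d]" using that ord bcd by auto
      then show ?thesis by (subst hash_5) (simp_all add: U_def)
    qed
    show ?thesis
      by (rule test_hues)
        (use T t ord in \<open>simp add: test_triple_def entry h test3_def shift\<close>)
  qed
  define T where "T = {0, 1, t, b, c, d}"
  have "{1, t, b, c, d} = T - {0}" "{0, t, b, c, d} = T - {1}" "{0, 1, b, c, d} = T - {t}"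
    "{0, 1, t, c, d} = T - {b}" "{0, 1, t, b, d} = T - {c}" "{0, 1, t, b, c} = T - {d}"
    using t ord bcd by (auto simp: T_def)
  note *[unfolded this]
  moreover have "(\<lambda>a. hue (hash (T - {a}))) ` {0, 1, t, b, c, d} = {hue (hash (T - {0})),
      hue (hash (T - {1})), hue (hash (T - {t})), hue (hash (T - {b})), hue (hash (T - {c})), hue (hash (T - {d}))}"
    by simp
  ultimately show ?thesis by (simp add: T_def[symmetric])
qed

section \<open>Running the verification\<close>

text \<open>
  Reduction modulo 71 by conditional subtractions of 71 times powers of 2. For rewriting,
  \<open>pick\<close> takes the place of a conditional: its arguments are evaluated before a
  branch is selected.
\<close>

primrec pick :: "bool \<Rightarrow> int \<Rightarrow> int \<Rightarrow> int" where
  "pick True m n = m"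
| "pick False m n = n"

definition reduce :: "int \<Rightarrow> int \<Rightarrow> int" where
  "reduce k n = pick (n < k) n (n - k)"

lemma reduce_range:
  assumes "0 \<le> n" "n < 2 * k"
  shows "0 \<le> reduce k n" "reduce k n < k"
  using assms by (cases "n < k"; simp add: reduce_def)+

lemma reduce_mod: "71 dvd k \<Longrightarrow> reduce k n mod 71 = n mod 71"
  by (cases "n < k") (auto simp: reduce_def mod_eq_dvd_iff)

lemma mod_71_reduce:
  assumes "0 \<le> n" "n < 9088"
  shows "n mod 71 = reduce 71 (reduce 142 (reduce 284 (reduce 568 (reduce 1136 (reduce 2272 (reduce 4544 n))))))"
    (is "_ = ?r")
proof -
  have "0 \<le> ?r" "?r < 71"
    using assms by (intro reduce_range; simp)+
  moreover have "?r mod 71 = n mod 71"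
    by (simp add: reduce_mod)
  ultimately show ?thesis by simp
qed

text \<open>
  The weight of \<open>n\<close> modulo 71 for \<open>n\<close> below 9088; the products of two
  residues are at most 4900.
\<close>

definition weight_mod :: "int \<Rightarrow> int" where
  "weight_mod n = weight
    (reduce 71 (reduce 142 (reduce 284 (reduce 568 (reduce 1136 (reduce 2272 (reduce 4544 n)))))))"

text \<open>
  The table of \<open>wt0 d e\<close> for \<open>d < e\<close> as a predicate: unfolding it over
  \<open>[1..70]\<close> turns the theorem \<open>wt0_table_70\<close> into one rewrite rule for
  each pair.
\<close>

primrec wt0_row :: "int \<Rightarrow> int list \<Rightarrow> bool" where
  "wt0_row d [] = True"
| "wt0_row d (e # es) = (wt0 d e = weight_mod (e * inv71 d) \<and> wt0_row d es)"

primrec wt0_table :: "int list \<Rightarrow> bool" where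
  "wt0_table [] = True"
| "wt0_table (d # ds) = (wt0_row d ds \<and> wt0_table ds)"

lemma wt0_eq: "0 \<le> e \<Longrightarrow> e \<le> 70 \<Longrightarrow> wt0 d e = weight_mod (e * inv71 d)"
  using inv71_range[of d] mult_mono[of e 70 "inv71 d" 70]
  by (simp add: wt0_def wt_def ratio_def weight_mod_def mod_71_reduce)

lemma wt0_row: "set es \<subseteq> {0..70} \<Longrightarrow> wt0_row d es"
  by (induction es) (auto simp: wt0_eq)

lemma wt0_table: "set ds \<subseteq> {0..70} \<Longrightarrow> wt0_table ds"
  by (induction ds) (auto simp: wt0_row)

lemma wt0_table_70: "wt0_table [1..70]"
  by (rule wt0_table) (auto simp only: set_upto atLeastAtMost_iff)

lemmas numeral_rules = arith_simps rel_simps if_True if_False refl add_0 add_0_right mult_zero_left mult_zero_right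
  diff_0_right diff_self simp_thms numeral_One one_add_one diff_numeral_special add_numeral_special mult_1_left mult_1_right

lemmas wt0_rules = wt0_table_70[simplified upto70 wt0_table.simps wt0_row.simps inv71_rules
  weight_mod_def reduce_def pick.simps weight_rules numeral_rules]

text \<open>
  Merges two ascending lists and checks that the result ascends strictly, starting above
  \<open>l\<close>. The lists are then disjoint.
\<close>

function merge_check :: "int \<Rightarrow> int list \<Rightarrow> int list \<Rightarrow> bool"
  and merge_step :: "bool \<Rightarrow> int \<Rightarrow> int \<Rightarrow> int list \<Rightarrow> int \<Rightarrow> int list \<Rightarrow> bool" where
  "merge_check l [] [] = True"
| "merge_check l (x # xs) [] = (l < x \<and> merge_check x xs [])"
| "merge_check l [] (y # ys) = (l < y \<and> merge_check y [] ys)"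
| "merge_check l (x # xs) (y # ys) = merge_step (x < y) l x xs y ys"
| "merge_step True l x xs y ys = (l < x \<and> merge_check x xs (y # ys))"
| "merge_step False l x xs y ys = (l < y \<and> merge_check y (x # xs) ys)"
  by pat_completeness auto
termination
  by (relation "measure (\<lambda>s. case s of Inl (l, xs, ys) \<Rightarrow> 2 * (length xs + length ys)
      | Inr (p, l, x, xs, y, ys) \<Rightarrow> 2 * (length xs + length ys) + 3)") auto

lemma merge_check_sound:
  "merge_check l xs ys \<Longrightarrow> (\<forall>z\<in>set xs \<union> set ys. l < z) \<and> set xs \<inter> set ys = {}"
  "merge_step p l x xs y ys \<Longrightarrow> p = (x < y) \<Longrightarrow>
    (\<forall>z\<in>set (x # xs) \<union> set (y # ys). l < z) \<and> set (x # xs) \<inter> set (y # ys) = {}"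
proof (induction l xs ys and p l x xs y ys rule: merge_check_merge_step.induct)
  case (5 l x xs y ys)
  then have IH: "l < x" "\<forall>z\<in>set xs \<union> set (y # ys). x < z" "set xs \<inter> set (y # ys) = {}" by auto
  then have "x \<notin> set (y # ys)" by blast
  with IH show ?case by (auto intro: less_trans)
next
  case (6 l x xs y ys)
  then have IH: "l < y" "\<forall>z\<in>set (x # xs) \<union> set ys. y < z" "set (x # xs) \<inter> set ys = {}" by auto
  then have "y \<notin> set (x # xs)" by blast
  with IH show ?case by (auto intro: less_trans)
qed (auto intro: less_trans)

lemma merge_check_values: "merge_check (- 1) (concat red_chunks) (concat blue_chunks)"
  by (simp only: red_chunks_def blue_chunks_def concat.simps append.simps merge_check.simps
    merge_step.simps numeral_rules)

lemma hue_Red: "list_all (list_all (\<lambda>n. hue n = Red)) red_chunks"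
  by (auto simp: list_all_iff hue_def)

lemma hue_Blue: "list_all (list_all (\<lambda>n. hue n = Blue)) blue_chunks"
  using merge_check_sound(1)[OF merge_check_values] by (auto simp: list_all_iff hue_def)

lemma hue_Grey: "hue 15276 = Grey"
proof -
  have "list_all (list_all (\<lambda>n. n \<noteq> 15276)) red_chunks" "list_all (list_all (\<lambda>n. n \<noteq> 15276)) blue_chunks"
    by (simp_all only: red_chunks_def blue_chunks_def list.pred_inject numeral_rules not_False_eq_True)
  then show ?thesis by (auto simp: list_all_iff hue_def)
qed

lemmas hue_rules = hue_Grey
  hue_Red[unfolded red_chunks_def list.pred_inject simp_thms]
  hue_Blue[unfolded blue_chunks_def list.pred_inject simp_thms]

lemma upto270: "[2..70::int] = [2, 3, 4, 5, 6, 7, 8, 9, 10, 11, 12, 13, 14, 15, 16, 17, 18, 19, 20, 21, 22, 23, 24, 25, 26,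
    27, 28, 29, 30, 31, 32, 33, 34, 35, 36, 37, 38, 39, 40, 41, 42, 43, 44, 45, 46, 47, 48, 49,
    50, 51, 52, 53, 54, 55, 56, 57, 58, 59, 60, 61, 62, 63, 64, 65, 66, 67, 68, 69, 70]"
  by code_simp

lemmas check_rules = check_def upto270 filter.simps admissible_def test_points_def rows.simps list.map
  entry_def swt_def test_rows.simps test_row.simps test_pair.simps walk.simps test1.simps test2.simps test3_def
  test4_def test5_def test6_def clash.simps join.simps hue.distinct list.set insert_iff empty_iff prod.inject
  wt0_rules hue_rules numeral_rules

text \<open>
  The normal forms \<open>{0, 1, 6, b, c, d}\<close>, given by \<open>(b, c, d)\<close>, of the
  6-sets all of whose 5-subsets have hash 15276.
\<close>

definition exceptional :: triples where
  "exceptional = [(7, 12, 13), (7, 36, 42), (7, 65, 66), (11, 61, 66)]"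

text \<open>
  The runs of the verification. The congruence rule keeps the simplifier from evaluating branches
  that are not taken.
\<close>

lemma check_3: "check [] 3"
  by (simp only: check_rules cong: if_weak_cong)

lemma check_4: "check [] 4"
  by (simp only: check_rules cong: if_weak_cong)

lemma check_6: "check exceptional 6"
  by (simp only: check_rules exceptional_def cong: if_weak_cong)

lemma check_rest: "check [] 5" "check [] 2" "check [] 7" "check [] 8" "check [] 16" "check [] 17"
  "check [] 21" "check [] 22" "check [] 23"
  by (simp_all only: check_rules cong: if_weak_cong)

lemma check_other:
  assumes "t \<in> {3, 4, 5, 2, 7, 8, 16, 17, 21, 22, 23}"
  shows "check [] t"
  using assms by (elim insertE emptyE) (simp_all only: check_3 check_4 check_rest)

section \<open>The colouring has no monochromatic 6-set\<close>

text \<open>The colouring. Additive energy decides for grey hashes.\<close>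

definition colour :: "int set \<Rightarrow> nat" where
  "colour S = (case hue (hash S) of Red \<Rightarrow> 0 | Blue \<Rightarrow> 1
    | Grey \<Rightarrow> if energy S = 57 then 0 else 1)"

lemma colour_affine:
  "\<not> 71 dvd u \<Longrightarrow> S \<subseteq> {0..70} \<Longrightarrow> colour (affine u v ` S) = colour S"
  by (simp add: colour_def hash_affine energy_affine)

lemma hash_exceptional:
  "hash {0, 1, 7, 12, 13} = 15276" "hash {1, 6, 7, 12, 13} = 15276"
  "hash {0, 1, 6, 7, 42} = 15276" "hash {1, 6, 7, 36, 42} = 15276"
  "hash {1, 6, 7, 65, 66} = 15276" "hash {0, 1, 7, 65, 66} = 15276"
  "hash {0, 1, 11, 61, 66} = 15276" "hash {1, 6, 11, 61, 66} = 15276"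
   by (subst hash_5, simp, simp only: wt_eq_wt0 wt0_rules numeral_rules)+ 

lemma energy_exceptional:
  "energy {0, 1, 7, 12, 13} = 57" "energy {1, 6, 7, 12, 13} = 65"
  "energy {0, 1, 6, 7, 42} = 57" "energy {1, 6, 7, 36, 42} = 65"
  "energy {1, 6, 7, 65, 66} = 57" "energy {0, 1, 7, 65, 66} = 65"
  "energy {0, 1, 11, 61, 66} = 57" "energy {1, 6, 11, 61, 66} = 65"
  by (simp_all add: energy_def)

lemma colours_exceptional:
  assumes "(b, c, d) \<in> set exceptional"
  shows "{0, 1} \<subseteq> (\<lambda>a. colour ({0, 1, 6, b, c, d} - {a})) ` {0, 1, 6, b, c, d}"
proof -
  note c = colour_def hash_exceptional energy_exceptional hue_Grey
  have sub: "{0, 1} \<subseteq> f ` A" if "f x = 0" "f y = 1" "x \<in> A" "y \<in> A"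
    for f :: "int \<Rightarrow> nat" and A x y
    using that by (auto simp: image_iff intro: bexI[of _ x] bexI[of _ y])
  consider "(b, c, d) = (7, 12, 13)" | "(b, c, d) = (7, 36, 42)" | "(b, c, d) = (7, 65, 66)"
    | "(b, c, d) = (11, 61, 66)"
    using assms by (auto simp: exceptional_def)
  then show ?thesis
  proof cases
    case 1
    have "{0, 1, 6, 7, 12, 13} - {6} = {0, 1, 7, 12, 13::int}"
      "{0, 1, 6, 7, 12, 13} - {0} = {1, 6, 7, 12, 13::int}" by auto
    with 1 show ?thesis by (intro sub[of _ 6 0]) (simp_all only: prod.inject c, simp_all)
  next
    case 2
    have "{0, 1, 6, 7, 36, 42} - {36} = {0, 1, 6, 7, 42::int}"
      "{0, 1, 6, 7, 36, 42} - {0} = {1, 6, 7, 36, 42::int}" by auto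
    with 2 show ?thesis by (intro sub[of _ 36 0]) (simp_all only: prod.inject c, simp_all)
  next
    case 3
    have "{0, 1, 6, 7, 65, 66} - {0} = {1, 6, 7, 65, 66::int}"
      "{0, 1, 6, 7, 65, 66} - {6} = {0, 1, 7, 65, 66::int}" by auto
    with 3 show ?thesis by (intro sub[of _ 0 6]) (simp_all only: prod.inject c, simp_all)
  next
    case 4
    have "{0, 1, 6, 11, 61, 66} - {6} = {0, 1, 11, 61, 66::int}"
      "{0, 1, 6, 11, 61, 66} - {0} = {1, 6, 11, 61, 66::int}" by auto
    with 4 show ?thesis by (intro sub[of _ 6 0]) (simp_all only: prod.inject c, simp_all)
  qed
qed

lemma colours_of_hues:
  assumes "{Red, Blue} \<subseteq> (\<lambda>a. hue (hash (f a))) ` A"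
  shows "{0, 1} \<subseteq> (\<lambda>a. colour (f a)) ` A"
proof -
  obtain a a' where a: "a \<in> A" "hue (hash (f a)) = Red" "a' \<in> A" "hue (hash (f a')) = Blue"
    using assms by auto
  then have "colour (f a) = 0" "colour (f a') = 1" by (simp_all add: colour_def)
  then show ?thesis using a(1,3) by (auto intro: rev_image_eqI)
qed

lemma two_colours_normal:
  assumes t: "t \<in> {3, 4, 5, 6, 2, 7, 8, 16, 17, 21, 22, 23}"
    and ord: "2 \<le> b" "b < c" "c < d" "d \<le> 70" and bcd: "t \<notin> {b, c, d}"
    and min: "\<And>x y z. {x, y, z} \<subseteq> {0, 1, t, b, c, d} \<Longrightarrow> distinct [x, y, z] \<Longrightarrow> wt 0 1 t \<le> wt x y z"
  shows "{0, 1} \<subseteq> (\<lambda>a. colour ({0, 1, t, b, c, d} - {a})) ` {0, 1, t, b, c, d}"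
proof (cases "t = 6")
  case True
  have "{Red, Blue} \<subseteq> (\<lambda>a. hue (hash ({0, 1, t, b, c, d} - {a}))) ` {0, 1, t, b, c, d}
      \<or> (b, c, d) \<in> set exceptional"
    by (rule check_sound[OF _ _ ord bcd min]) (simp_all add: True check_6)
  then show ?thesis
    using colours_of_hues[of "\<lambda>a. {0, 1, t, b, c, d} - {a}"] colours_exceptional
    unfolding True by blast
next
  case False
  then have "check [] t" using t by (intro check_other) auto
  moreover have "t \<notin> {0, 1}" using t by auto
  ultimately have "{Red, Blue} \<subseteq> (\<lambda>a. hue (hash ({0, 1, t, b, c, d} - {a}))) ` {0, 1, t, b, c, d}
      \<or> (b, c, d) \<in> set []"
    by (rule check_sound[OF _ _ ord bcd min])
  then show ?thesis
    by (intro colours_of_hues) simp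
qed

text \<open>
  Two points can be moved to 0 and 1; the images of the other points are then ratios.
\<close>

lemma normalise:
  assumes "x \<in> {0..70}" "y \<in> {0..70}" "x \<noteq> y"
  shows "\<exists>u v. \<not> 71 dvd u \<and> affine u v x = 0 \<and> affine u v y = 1 \<and> (\<forall>z. affine u v z = ratio x y z)"
proof -
  define u where "u = inv71 (y - x)"
  have "\<not> 71 dvd y - x"
  proof
    assume "71 dvd y - x"
    then have "[y = x] (mod 71)" by (simp add: cong_iff_dvd_diff)
    then show False using cong_range_eq assms by blast
  qed
  note inv = inv71_mult[OF this]
  have z: "affine u (- x * u) z = ratio x y z" for z
    by (simp add: affine_def ratio_def u_def algebra_simps)
  have "\<not> 71 dvd u"
  proof
    assume "71 dvd u"
    then have "(y - x) * u mod 71 = 0" by simp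
    then show False using inv by (simp add: cong_def u_def)
  qed
  moreover have "affine u (- x * u) x = 0" "affine u (- x * u) y = 1"
    unfolding z using inv by (simp_all add: ratio_def cong_def)
  ultimately show ?thesis using z by blast
qed

text \<open>
  The orderings of a triple realise all ratios of a class, so one of them has the representative
  as its ratio.
\<close>

lemma representative_triple:
  assumes "x \<in> {0..70}" "y \<in> {0..70}" "z \<in> {0..70}" "distinct [x, y, z]"
  obtains x' y' z' where "{x', y', z'} = {x, y, z}" "distinct [x', y', z']"
    "wt x' y' z' = wt x y z" "ratio x' y' z' \<in> {3, 4, 5, 6, 2, 7, 8, 16, 17, 21, 22, 23}"
proof -
  have nd: "\<not> 71 dvd p - q" if "p \<in> {x, y, z}" "q \<in> {x, y, z}" "p \<noteq> q" for p q
  proof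
    assume "71 dvd p - q"
    then have "[p = q] (mod 71)" by (simp add: cong_iff_dvd_diff)
    moreover have "p \<in> {0..70}" "q \<in> {0..70}" using that assms by auto
    ultimately show False using cong_range_eq that by blast
  qed
  obtain u v where uv: "\<not> 71 dvd u" "affine u v x = 0" "affine u v y = 1"
    "\<And>w. affine u v w = ratio x y w"
    using normalise[of x y] assms by (metis distinct_length_2_or_more)
  have "affine u v z \<noteq> affine u v x" "affine u v z \<noteq> affine u v y"
    using inj_onD[OF inj_on_affine[OF uv(1)]] assms by (metis distinct_length_2_or_more)+
  then have "ratio x y z \<noteq> 0" "ratio x y z \<noteq> 1"
    unfolding uv(2,3) unfolding uv(4) .
  then have "ratio x y z \<in> {2..70}"
    using ratio_range[of x y z] by auto
  then obtain s where s: "s \<in> {3, 4, 5, 6, 2, 7, 8, 16, 17, 21, 22, 23}"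
    "s \<in> {ratio x y z, ratio x z y, ratio y x z, ratio y z x, ratio z x y, ratio z y x}"
    using bspec[OF representatives] ratio_swap_xy[OF nd, of y x z] ratio_swap_xy[OF nd, of z x y]
      ratio_swap_yz[of x z y] ratio_swap_yz[of y z x] ratio_swap_yz[of z y x] assms
    by (metis (no_types, lifting) distinct_length_2_or_more insertCI)
  note w = wt_swap_xy wt_swap_yz
  from s(2) consider "s = ratio x y z" | "s = ratio x z y" | "s = ratio y x z"
    | "s = ratio y z x" | "s = ratio z x y" | "s = ratio z y x" by blast
  then show thesis
  proof cases
    case 1 then show thesis using s(1) assms that[of x y z] by auto
  next
    case 2 then show thesis using s(1) assms that[of x z y] by (auto simp: w)
  next
    case 3 then show thesis using s(1) assms that[of y x z] by (auto simp: w)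
  next
    case 4 then show thesis using s(1) assms that[of y z x] by (auto simp: w)
  next
    case 5 then show thesis using s(1) assms that[of z x y] by (auto simp: w)
  next
    case 6 then show thesis using s(1) assms that[of z y x] by (auto simp: w)
  qed
qed

text \<open>Both colours occur among the 5-subsets of every 6-set.\<close>

lemma two_colours:
  assumes T: "T \<subseteq> {0..70}" "card T = 6"
  shows "{0, 1} \<subseteq> (\<lambda>a. colour (T - {a})) ` T"
proof -
  have fin: "finite T" using T(2) card.infinite by fastforce
  \<comment> \<open>the ordered triples of distinct elements\<close>
  define P where "P = {(x, y, z). {x, y, z} \<subseteq> T \<and> distinct [x, y, z]}"
  have "P \<subseteq> T \<times> T \<times> T" by (auto simp: P_def)
  then have "finite P" using fin finite_subset by blast
  moreover have "P \<noteq> {}"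
  proof -
    obtain A where A: "A \<subseteq> T" "card A = 3"
      using obtain_subset_with_card_n[of 3 T] T(2) by auto
    then obtain x y z where "A = {x, y, z}" "x \<noteq> y" "y \<noteq> z" "x \<noteq> z"
      unfolding card_3_iff by blast
    then have "(x, y, z) \<in> P" using A by (simp add: P_def)
    then show ?thesis by blast
  qed
  ultimately obtain p where p: "is_arg_min (\<lambda>(x, y, z). wt x y z) (\<lambda>p. p \<in> P) p"
    using ex_is_arg_min_if_finite by blast
  obtain x y z where "p = (x, y, z)" by (cases p)
  with p have xyz: "{x, y, z} \<subseteq> T" "distinct [x, y, z]"
    and min: "\<And>x' y' z'. {x', y', z'} \<subseteq> T \<Longrightarrow> distinct [x', y', z'] \<Longrightarrow> wt x y z \<le> wt x' y' z'"
    by (auto simp: is_arg_min_linorder P_def)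
  have "x \<in> {0..70}" "y \<in> {0..70}" "z \<in> {0..70}" using xyz(1) T(1) by auto
  from this xyz(2) obtain x' y' z' where rep: "{x', y', z'} = {x, y, z}" "distinct [x', y', z']"
    "wt x' y' z' = wt x y z" "ratio x' y' z' \<in> {3, 4, 5, 6, 2, 7, 8, 16, 17, 21, 22, 23}"
    by (rule representative_triple)
  have T3: "x' \<in> T" "y' \<in> T" "z' \<in> T" using rep(1) xyz(1) by blast+
  then have "x' \<in> {0..70}" "y' \<in> {0..70}" "x' \<noteq> y'" using T(1) rep(2) by auto
  then obtain u v where uv: "\<not> 71 dvd u" "affine u v x' = 0" "affine u v y' = 1"
    "\<And>w. affine u v w = ratio x' y' w"
    using normalise[of x' y'] by blast
  define g where "g = affine u v"
  define t where "t = g z'"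
  have t: "t \<in> {3, 4, 5, 6, 2, 7, 8, 16, 17, 21, 22, 23}" using rep(4) by (simp add: t_def g_def uv)
  have inj: "inj_on g T" unfolding g_def using inj_on_affine[OF uv(1)] T(1) by (rule inj_on_subset)
  have g: "g x' = 0" "g y' = 1" using uv by (simp_all add: g_def)
  have sub: "{0, 1, t} \<subseteq> g ` T" using T3 g unfolding t_def by (metis image_eqI insert_subset empty_subsetI)
  have "card {0, 1, t} = 3" using t by auto
  then have "card (g ` T - {0, 1, t}) = 3"
    using sub T(2) by (simp add: card_Diff_subset card_image[OF inj])
  then obtain b c d where bcd: "g ` T - {0, 1, t} = {b, c, d}" "b < c" "c < d"
    by (rule obtain_sorted_3)
  then have gT: "g ` T = {0, 1, t, b, c, d}" using sub by blast
  have range: "g ` T \<subseteq> {0..70}" using affine_range by (auto simp: g_def)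
  have "{0, 1} \<subseteq> (\<lambda>a. colour ({0, 1, t, b, c, d} - {a})) ` {0, 1, t, b, c, d}"
  proof (rule two_colours_normal[OF t _ bcd(2,3)])
    have "b \<in> g ` T - {0, 1, t}" "d \<in> g ` T" using bcd(1) gT by auto
    then have "b \<noteq> 0" "b \<noteq> 1" "b \<in> {0..70}" "d \<in> {0..70}" using range by auto
    then show "2 \<le> b" "d \<le> 70" by auto
    show "t \<notin> {b, c, d}" using bcd(1) by blast
    fix X Y Z assume XYZ: "{X, Y, Z} \<subseteq> {0, 1, t, b, c, d}" "distinct [X, Y, Z]"
    then have "X \<in> g ` T" "Y \<in> g ` T" "Z \<in> g ` T" unfolding gT by auto
    then obtain p q r where pqr: "X = g p" "Y = g q" "Z = g r" "p \<in> T" "q \<in> T" "r \<in> T" by blast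
    then have "wt x y z \<le> wt p q r" using XYZ(2) by (intro min) auto
    moreover have "wt X Y Z = wt p q r" "wt 0 1 t = wt x' y' z'"
      using wt_affine[OF uv(1)] g pqr by (simp_all add: t_def g_def) (metis)
    ultimately show "wt 0 1 t \<le> wt X Y Z" using rep(3) by simp
  qed
  then have "{0, 1} \<subseteq> (\<lambda>a. colour (g ` T - {g a})) ` T"
    unfolding gT[symmetric] image_image .
  moreover have "colour (g ` T - {g a}) = colour (T - {a})" if "a \<in> T" for a
  proof -
    have "g ` T - {g a} = g ` (T - {a})"
      using inj_on_image_set_diff[OF inj, of T "{a}"] that by auto
    then show ?thesis
      unfolding g_def using colour_affine[OF uv(1)] T(1) by (metis Diff_subset subset_trans)
  qed
  ultimately show ?thesis by (metis (mono_tags, lifting) image_cong)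
qed

lemma not_partn_lst:
  fixes N :: nat
  assumes "N \<le> 71"
  shows "\<not> partn_lst {1..N} [6, 6] 5"
proof
  assume part: "partn_lst {1..N} [6, 6] 5"
  \<comment> \<open>the points 1, ..., N become the residues 0, ..., N - 1\<close>
  define e where "e = (\<lambda>n. int n - 1)"
  have inj: "inj_on e A" for A by (simp add: e_def inj_on_def)
  have "colour S < 2" for S by (simp add: colour_def split: hue.split)
  then have "(\<lambda>S. colour (e ` S)) \<in> nsets {1..N} 5 \<rightarrow> {..<length [6, 6::nat]}"
    by (simp add: numeral_2_eq_2)
  then obtain i H where i: "i < length [6, 6::nat]" and H: "H \<in> nsets {1..N} ([6, 6] ! i)"
    and mono: "(\<lambda>S. colour (e ` S)) ` nsets H 5 \<subseteq> {i}"
    using part unfolding partn_lst_def monochromatic_def by blast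
  have "[6, 6::nat] ! i = 6" using i by (auto simp: less_Suc_eq)
  with H have H: "H \<subseteq> {1..N}" "card H = 6" "finite H" by (simp_all add: nsets_def)
  have "e ` H \<subseteq> {0..70}" using H(1) assms by (auto simp: e_def)
  moreover have "card (e ` H) = 6" using H(2) card_image[OF inj] by simp
  ultimately have "{0, 1} \<subseteq> (\<lambda>a. colour (e ` H - {a})) ` e ` H" by (rule two_colours)
  moreover have "colour (e ` H - {e h}) = i" if "h \<in> H" for h
  proof -
    have "e ` H - {e h} = e ` (H - {h})"
      using inj_on_image_set_diff[OF inj[of H], of H "{h}"] that by auto
    moreover have "H - {h} \<in> nsets H 5"
      using H(2,3) that by (auto simp: nsets_def)
    ultimately show ?thesis using mono by auto
  qed
  ultimately have "0 = i" "1 = i" by (auto simp: image_iff)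
  then show False by simp
qed

theorem mainTheorem6:
  shows "ramsey_number 5 6 6 \<ge> 72"
proof (rule ccontr)
  assume "\<not> ramsey_number 5 6 6 \<ge> 72"
  then have "\<not> partn_lst {1..ramsey_number 5 6 6} [6, 6] 5"
    by (intro not_partn_lst) simp
  moreover have "partn_lst {1..ramsey_number 5 6 6} [6, 6] 5"
    unfolding ramsey_number_def using ramsey_number_exists by (rule LeastI_ex)
  ultimately show False by contradiction
qed

end
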